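(* Let $\alpha>-1$ and $t\ge0$. For every integer $n\ge1$ the recurrence coefficients $\alpha_n=\alpha_n(t,\alpha)$ and $\beta_n=\beta_n(t,\alpha)$ satisfy the first-order system of difference equations $$\alpha t+2\beta_n(\alpha_n+\alpha_{n-1})+(2n+\alpha)\left[\alpha_n(2n+2+\alpha-\alpha_n)-3\beta_n-\beta_{n+1}\right]=0,$$ $$\left[nt-\beta_n(\alpha_n+\alpha_{n-1}-4n-2\alpha)\right]\left[(n+\alpha)t+\beta_n(\alpha_n+\alpha_{n-1}-4n-2\alpha)\right]+(2n+\alpha)^2\beta_n(\alpha_n-2n-1-\alpha)(\alpha_{n-1}-2n+1-\alpha)=0.$$
   Context: For $\alpha>-1$, $t\ge0$, let $w(x;t,\alpha)=x^\alpha e^{-x-t/x}$ on $(0,\infty)$, and let $P_n(x;t,\alpha)$, $n=0,1,2,\dots$, be the monic orthogonal polynomials of degree $n$ with respect to $w$: $\int_0^\infty P_jP_kw\,dx=h_j\delta_{jk}$, $h_j>0$. The recurrence coefficients $\alpha_n$, $\beta_n$ (not to be confused with the parameter $\alpha$) are defined by $xP_n=P_{n+1}+\alpha_nP_n+\beta_nP_{n-1}$ with $P_0=1$, $\beta_0P_{-1}=0$. *)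

theory Defs
  imports "HOL-Analysis.Analysis" "HOL-Computational_Algebra.Polynomial"
begin

definition weight :: "real \<Rightarrow> real \<Rightarrow> real \<Rightarrow> real" where
  "weight t \<alpha> x = x powr \<alpha> * exp (- x - t / x)"

(* The Lebesgue integral of a non-integrable function is 0 by convention; for
   alpha > -1 and t >= 0 every polynomial times the weight is integrable. *)
definition monic_orthogonal_polynomials :: "(real \<Rightarrow> real) \<Rightarrow> (nat \<Rightarrow> real poly) \<Rightarrow> bool" where
  "monic_orthogonal_polynomials w P \<longleftrightarrow>
     (\<forall>n. degree (P n) = n \<and> lead_coeff (P n) = 1) \<and>
     (\<exists>h :: nat \<Rightarrow> real. (\<forall>j. h j > 0) \<and>
        (\<forall>j k. (LINT x:{0<..}|lborel. poly (P j) x * poly (P k) x * w x)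
                 = (if j = k then h j else 0)))"

(* The conditional encodes the convention that the term with index -1 is absent when
   n = 0; consequently b 0 is unconstrained. *)
definition recurrence_coefficients ::
    "(nat \<Rightarrow> real poly) \<Rightarrow> (nat \<Rightarrow> real) \<Rightarrow> (nat \<Rightarrow> real) \<Rightarrow> bool" where
  "recurrence_coefficients P a b \<longleftrightarrow>
     P 0 = 1 \<and>
     (\<forall>n. [:0, 1:] * P n = P (n + 1) + smult (a n) (P n)
            + (if n = 0 then 0 else smult (b n) (P (n - 1))))"

end

theory Submission
  imports Defs "HOL-Real_Asymp.Real_Asymp"
begin

text \<open>
  Integration by parts gives the Pearson equation \<open>L (x\<^sup>2 p' + (t + (2 + \<alpha>) x - x\<^sup>2) p) = 0\<close> for the
  functional \<open>L p = \<integral> p w\<close>; the rest is algebra. Expanding \<open>x\<^sup>2 P\<^sub>n'\<close> in the orthogonal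
  polynomials expresses it through \<open>P\<^sub>n\<close> and \<open>P\<^sub>n\<^sub>-\<^sub>1\<close> with coefficients linear in \<open>x\<close>
  that involve \<open>a\<^sub>n\<close>, \<open>b\<^sub>n\<close> and one auxiliary quantity \<open>r\<^sub>n\<close>. Testing the Pearson equation
  with \<open>P\<^sub>n\<^sup>2\<close> gives one relation for \<open>r\<^sub>n\<close>, and the vanishing to second order at \<open>0\<close> of
  the determinant of the system for \<open>(P\<^sub>n, P\<^sub>n\<^sub>-\<^sub>1)\<close> gives two more. Eliminating \<open>r\<^sub>n\<close>
  yields the two difference equations.
\<close>

section \<open>Orthogonal polynomials of an abstract linear functional\<close>

text \<open>Since \<open>P (0 - 1)\<close> is \<open>P 0\<close> on naturals, \<open>b 0 = 0\<close>
  is what makes \<open>rec\<close> correct at index 0 without a case distinction.\<close>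

locale semiclassical_functional =
  fixes L :: "real poly \<Rightarrow> real" and P :: "nat \<Rightarrow> real poly"
    and a b h :: "nat \<Rightarrow> real" and t \<alpha> :: real
  assumes L_add: "L (p + q) = L p + L q"
    and L_smult: "L (smult c p) = c * L p"
    and pearson: "L ([:0, 0, 1:] * pderiv p + [:t, 2 + \<alpha>, -1:] * p) = 0"
    and deg_P [simp]: "degree (P n) = n"
    and lead_P: "coeff (P n) n = 1"
    and orth: "L (P j * P k) = (if j = k then h j else 0)"
    and h_nz [simp]: "h n \<noteq> 0"
    and b_0 [simp]: "b 0 = 0"
    and rec: "[:0, 1:] * P n = P (Suc n) + smult (a n) (P n) + smult (b n) (P (n - 1))"
begin

lemma L_0 [simp]: "L 0 = 0"
  using L_smult[of 0 0] by simp

lemma L_diff: "L (p - q) = L p - L q"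
  using L_add[of p "smult (-1) q"] L_smult[of "-1" q] by simp

lemma P_0: "P 0 = 1"
  using lead_P[of 0] deg_P[of 0] by (metis degree_0_id one_pCons)

text \<open>The second alternative is the one that holds for \<open>m = 0\<close>, where no degree
  lies below \<open>m\<close>.\<close>

lemma degree_eliminate:
  assumes "degree q \<le> m"
  shows "degree (q - smult (coeff q m) (P m)) < m \<or> q = smult (coeff q m) (P m)"
proof (cases "m = 0")
  case True
  then show ?thesis
    using assms P_0 degree_0_id[of q] by (auto simp: one_pCons)
next
  case False
  have vanish: "coeff (q - smult (coeff q m) (P m)) i = 0" if "i \<ge> m" for i
    using that assms lead_P[of m] by (cases "i = m") (auto simp: coeff_eq_0)
  have "degree (q - smult (coeff q m) (P m)) \<le> m - 1"
    using False by (intro degree_le allI impI vanish) linarith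
  with False show ?thesis by auto
qed

lemma orth_low: "degree q < n \<Longrightarrow> L (P n * q) = 0"
proof (induction "degree q" arbitrary: q rule: less_induct)
  case less
  let ?m = "degree q" let ?q = "q - smult (coeff q ?m) (P ?m)"
  have "L (P n * ?q) = 0"
    using degree_eliminate[of q ?m] less by fastforce
  moreover have "L (P n * q) = L (P n * ?q) + coeff q ?m * L (P n * P ?m)"
    by (simp add: right_diff_distrib L_diff L_smult)
  ultimately show ?case
    using less.prems by (simp add: orth)
qed

lemma orth_top:
  assumes "degree q \<le> n"
  shows "L (P n * q) = coeff q n * h n"
proof -
  let ?q = "q - smult (coeff q n) (P n)"
  have "L (P n * ?q) = 0"
    using degree_eliminate[OF assms] orth_low by fastforce
  then show ?thesis
    by (simp add: right_diff_distrib L_diff L_smult orth)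
qed

text \<open>Pairing \<open>p\<close> with \<open>P (degree p)\<close> returns the leading
  coefficient of \<open>p\<close> times a nonzero \<open>h\<close>.\<close>

lemma eq_0_if_orthogonal:
  assumes "\<And>q. degree q \<le> degree p \<Longrightarrow> L (p * q) = 0"
  shows "p = 0"
  using assms[of "P (degree p)"] orth_top[of p "degree p"] by (simp add: mult.commute)

lemma L_x_P:
  "L ([:0, 1:] * P n * q) = L (P (Suc n) * q) + a n * L (P n * q) + b n * L (P (n - 1) * q)"
  unfolding rec by (simp add: distrib_right L_add L_smult)

text \<open>Both sides are L(x P_n P_(n+1)), with the recurrence applied to either factor.\<close>

lemma h_Suc: "h (Suc n) = b (Suc n) * h n"
proof -
  have "L ([:0, 1:] * P (Suc n) * P n) = b (Suc n) * h n"
    unfolding L_x_P by (simp add: orth)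
  moreover have "L ([:0, 1:] * P (Suc n) * P n) = L ([:0, 1:] * P n * P (Suc n))"
    by (simp add: mult_ac)
  moreover have "\<dots> = h (Suc n)"
    unfolding L_x_P by (simp add: orth)
  ultimately show ?thesis by simp
qed

lemma b_h: "b n * h (n - 1) = (if n = 0 then 0 else h n)"
  by (cases n) (simp_all add: h_Suc)

lemma b_nz: "b (Suc n) \<noteq> 0"
  using h_Suc[of n] h_nz[of "Suc n"] by auto

text \<open>Index 0 is separate because \<open>0 - 1 = 0\<close> would pick the leading coefficient
  1.\<close>

definition subleading :: "nat \<Rightarrow> real" where
  "subleading n = (if n = 0 then 0 else coeff (P n) (n - 1))"

lemma subleading_Suc: "subleading (Suc n) = subleading n - a n"
proof -
  have "coeff ([:0, 1:] * P n) n = coeff (P (Suc n)) n + a n + b n * coeff (P (n - 1)) n"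
    unfolding rec by (simp add: lead_P)
  moreover have "b n * coeff (P (n - 1)) n = 0"
    by (cases n) (auto simp: coeff_eq_0)
  moreover have "coeff ([:0, 1:] * P n) n = subleading n"
    by (simp add: subleading_def coeff_pCons split: nat.splits)
  moreover have "subleading (Suc n) = coeff (P (Suc n)) n"
    by (simp add: subleading_def)
  ultimately show ?thesis by linarith
qed

section \<open>The structure relation and the auxiliary quantity \<open>r n\<close>\<close>

text \<open>Deviation of \<open>a n\<close> from its value for the Laguerre weight, the case
  \<open>t = 0\<close>.\<close>

definition A :: "nat \<Rightarrow> real" where "A n = a n - 2 * real n - 1 - \<alpha>"

definition r :: "nat \<Rightarrow> real" where "r n = b n + subleading n"

text \<open>The Pearson equation for \<open>p * q\<close>, read as integration by parts: it moves
  the derivative from \<open>p\<close> to \<open>q\<close>.\<close>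

lemma pearson_prod:
  "L ([:0, 0, 1:] * pderiv p * q) + L ([:0, 0, 1:] * p * pderiv q)
     = L ([:- t, - 2 - \<alpha>, 1:] * p * q)"
proof -
  have "L ([:0, 0, 1:] * pderiv p * q + [:0, 0, 1:] * p * pderiv q
       - [:- t, - 2 - \<alpha>, 1:] * p * q) = 0"
    using pearson[of "p * q"]
    by (rule back_subst[where P = "\<lambda>p. L p = 0"])
      (rule poly_ext, simp add: pderiv_mult algebra_simps)
  then show ?thesis unfolding L_add L_diff by linarith
qed

text \<open>The difference of the two sides has degree below \<open>n\<close> because of the choice of \<open>r n\<close>,
  and it is orthogonal to all polynomials of degree below \<open>n\<close> because of the choice of
  \<open>A n\<close>.\<close>
lemma structure_relation:
  "[:0, 0, 1:] * pderiv (P n)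
     = [:- r n, real n:] * P n + smult (b n) ([:A n, 1:] * P (n - 1))"
proof (cases "n = 0")
  case True
  then show ?thesis by (simp add: P_0 r_def subleading_def)
next
  case False
  then obtain m where n: "n = Suc m" by (cases n) auto
  define N where "N = [:0, 0, 1:] * pderiv (P n)
     - ([:- r n, real n:] * P n + smult (b n) ([:A n, 1:] * P (n - 1)))"
  have "coeff N i = 0" if "i > m" for i
  proof -
    obtain j where j: "i = Suc j" using \<open>i > m\<close> by (cases i) auto
    have "j \<ge> m" using that j by simp
    have "coeff N i = real j * coeff (P n) j + r n * coeff (P n) (Suc j) - real n * coeff (P n) j
       - b n * (A n * coeff (P m) (Suc j) + coeff (P m) j)"
      unfolding N_def j n
      by (cases j) (simp_all add: coeff_pCons coeff_pderiv algebra_simps)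
    \<comment> \<open>Only \<open>j = m\<close>, the coefficient of x^n, involves the choice of
      \<open>r n\<close>; the higher ones vanish for degree reasons.\<close>
    moreover consider "j = m" | "j = n" | "j > n" using \<open>j \<ge> m\<close> n by linarith
    then have "real j * coeff (P n) j + r n * coeff (P n) (Suc j) - real n * coeff (P n) j
       - b n * (A n * coeff (P m) (Suc j) + coeff (P m) j) = 0"
    proof cases
      case 1
      have "r n = b n + coeff (P n) m" by (simp add: r_def subleading_def n)
      moreover have "coeff (P n) (Suc m) = 1" using lead_P[of n] n by simp
      moreover have "coeff (P m) (Suc m) = 0" by (simp add: coeff_eq_0)
      ultimately show ?thesis unfolding 1 by (simp add: lead_P n algebra_simps)
    qed (simp_all add: coeff_eq_0 n)
    ultimately show ?thesis by simp
  qed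
  then have degN: "degree N \<le> m" by (intro degree_le) blast
  have "N = 0"
  proof (rule eq_0_if_orthogonal)
    fix q :: "real poly" assume "degree q \<le> degree N"
    then have dq: "degree q \<le> m" using degN by simp
    have dxq: "degree ([:0, 1:] * q) \<le> n"
      using dq n by (simp add: degree_pCons_eq_if)
    have dxxq: "degree ([:0, 0, 1:] * pderiv q) \<le> n"
      using dq n degree_pderiv[of q] pderiv_eq_0_iff[of q]
      by (cases "degree q = 0") (auto simp: degree_pCons_eq_if split: if_splits)
    have c2: "coeff ([:0, 0, 1:] * pderiv q) n = real m * coeff q m"
      unfolding n by (cases m) (simp_all add: coeff_pCons coeff_pderiv)
    have e0: "L (P n * q) = 0" using orth_low[of q n] dq n by simp
    have e1: "L ([:0, 1:] * P n * q) = coeff q m * h n"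
      using orth_top[OF dxq] by (simp add: mult_ac n)
    have e2: "L (P n * ([:0, 0, 1:] * pderiv q)) = real m * coeff q m * h n"
      using orth_top[OF dxxq] c2 by simp
    \<comment> \<open>The last term stays unevaluated, since it cancels against the same term of
      \<open>L (N * q)\<close>.\<close>
    have e3: "L ([:0, 1:] * P n * ([:0, 1:] * q))
       = a n * (coeff q m * h n) + b n * L (P m * ([:0, 1:] * q))"
    proof -
      have "L (P (Suc n) * ([:0, 1:] * q)) = 0"
        using dxq by (intro orth_low) simp
      moreover have "L (P n * ([:0, 1:] * q)) = coeff q m * h n"
        using orth_top[OF dxq] by (simp add: n)
      ultimately show ?thesis unfolding L_x_P by (simp add: n)
    qed
    have e4: "L (P m * q) = coeff q m * h m" using orth_top[OF dq] .
    have "L (N * q) = L ([:0, 0, 1:] * pderiv (P n) * q) - real n * L ([:0, 1:] * P n * q)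
        + r n * L (P n * q) - b n * (A n * L (P m * q) + L (P m * ([:0, 1:] * q)))"
    proof -
      have "N * q = [:0, 0, 1:] * pderiv (P n) * q - smult (real n) ([:0, 1:] * P n * q)
        + smult (r n) (P n * q)
        - smult (b n) (smult (A n) (P m * q) + P m * ([:0, 1:] * q))"
        unfolding N_def by (rule poly_ext) (simp add: n algebra_simps)
      then show ?thesis by (simp only: L_add L_diff L_smult)
    qed
    moreover have "L ([:0, 0, 1:] * pderiv (P n) * q) =
        L ([:0, 1:] * P n * ([:0, 1:] * q)) - (2 + \<alpha>) * L ([:0, 1:] * P n * q) - t * L (P n * q)
        - L (P n * ([:0, 0, 1:] * pderiv q))"
    proof -
      have "[:- t, - 2 - \<alpha>, 1:] * P n * q = [:0, 1:] * P n * ([:0, 1:] * q)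
        - smult (2 + \<alpha>) ([:0, 1:] * P n * q) - smult t (P n * q)"
        by (rule poly_ext) (simp add: algebra_simps)
      then have "L ([:- t, - 2 - \<alpha>, 1:] * P n * q) = L ([:0, 1:] * P n * ([:0, 1:] * q))
        - (2 + \<alpha>) * L ([:0, 1:] * P n * q) - t * L (P n * q)"
        by (simp only: L_diff L_smult)
      then show ?thesis using pearson_prod[of "P n" q] by (simp add: mult_ac)
    qed
    \<comment> \<open>With \<open>h n = b n * h m\<close>, everything left is
      \<open>coeff q m * h n\<close> times \<open>a n - 2 - \<alpha> - m - n - A n\<close>, which is
      0 as \<open>m = n - 1\<close>.\<close>
    ultimately show "L (N * q) = 0"
      unfolding e0 e1 e2 e3 e4 using h_Suc[of m]
      by (simp add: n A_def algebra_simps)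
  qed
  then show ?thesis by (simp add: N_def)
qed

text \<open>For p = q = P_n both terms on the left of \<open>pearson_prod\<close> agree. The
  structure relation evaluates them, the recurrence evaluates the right side.\<close>

lemma r_eq: "2 * r n = (2 * real n + 2 + \<alpha>) * a n + t + b n - b (Suc n) - (a n)\<^sup>2"
proof -
  have x1: "L ([:0, 1:] * P n * P n) = a n * h n"
    unfolding L_x_P by (cases n) (simp_all add: orth)
  \<comment> \<open>The factor \<open>b n\<close> keeps this valid at \<open>n = 0\<close>, where
    both sides are 0.\<close>
  have x1': "b n * L ([:0, 1:] * P (n - 1) * P n) = b n * h n"
    unfolding L_x_P by (cases n) (simp_all add: orth)
  have x2: "L ([:0, 1:] * P n * ([:0, 1:] * P n)) = (b (Suc n) + (a n)\<^sup>2 + b n) * h n"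
  proof -
    have c: "P k * ([:0, 1:] * P n) = [:0, 1:] * P n * P k" for k by (simp add: mult_ac)
    have "L ([:0, 1:] * P n * P (Suc n)) = b (Suc n) * h n"
      unfolding L_x_P by (cases n) (simp_all add: orth h_Suc)
    moreover have "L ([:0, 1:] * P n * P (n - 1)) = b n * h (n - 1)"
      if "n > 0" unfolding L_x_P using that by (cases n) (simp_all add: orth)
    ultimately show ?thesis
      unfolding L_x_P[of n "[:0, 1:] * P n"] c x1 using b_h[of n]
      by (cases "n = 0") (simp_all add: algebra_simps power2_eq_square)
  qed
  have "[:0, 0, 1:] * pderiv (P n) * P n = smult (real n) ([:0, 1:] * P n * P n)
      - smult (r n) (P n * P n)
      + smult (b n) ([:0, 1:] * P (n - 1) * P n) + smult (b n * A n) (P (n - 1) * P n)"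
    unfolding structure_relation
    by (rule poly_ext) (simp add: algebra_simps)
  then have "L ([:0, 0, 1:] * pderiv (P n) * P n)
     = real n * L ([:0, 1:] * P n * P n) - r n * L (P n * P n)
      + b n * L ([:0, 1:] * P (n - 1) * P n) + b n * A n * L (P (n - 1) * P n)"
    by (simp only: L_add L_diff L_smult)
  also have "\<dots> = (real n * a n - r n + b n) * h n"
    unfolding x1 x1' by (cases n) (simp_all add: orth algebra_simps)
  finally have 1: "L ([:0, 0, 1:] * pderiv (P n) * P n) = (real n * a n - r n + b n) * h n" .
  have "[:- t, - 2 - \<alpha>, 1:] * P n * P n = [:0, 1:] * P n * ([:0, 1:] * P n)
     - smult (2 + \<alpha>) ([:0, 1:] * P n * P n) - smult t (P n * P n)"
    by (rule poly_ext) (simp add: algebra_simps)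
  then have "L ([:- t, - 2 - \<alpha>, 1:] * P n * P n)
     = L ([:0, 1:] * P n * ([:0, 1:] * P n))
     - (2 + \<alpha>) * L ([:0, 1:] * P n * P n) - t * L (P n * P n)"
    by (simp only: L_diff L_smult)
  also have "\<dots> = (b (Suc n) + (a n)\<^sup>2 + b n - (2 + \<alpha>) * a n - t) * h n"
    unfolding x1 x2 by (simp add: orth algebra_simps)
  finally have "2 * ((real n * a n - r n + b n) * h n)
      = (b (Suc n) + (a n)\<^sup>2 + b n - (2 + \<alpha>) * a n - t) * h n"
    using pearson_prod[of "P n" "P n"] 1 by (simp add: mult_ac)
  then have "(2 * (real n * a n - r n + b n)) * h n
      = (b (Suc n) + (a n)\<^sup>2 + b n - (2 + \<alpha>) * a n - t) * h n"
    by simp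
  then have "2 * (real n * a n - r n + b n) = b (Suc n) + (a n)\<^sup>2 + b n - (2 + \<alpha>) * a n - t"
    by simp
  then show ?thesis by (simp add: algebra_simps)
qed

lemma r_add: "r (Suc n) + r n = t - a n * A n"
proof -
  have "r (Suc n) + r n = 2 * r n + b (Suc n) - b n - a n"
    using subleading_Suc[of n] by (simp add: r_def)
  also have "\<dots> = t - a n * A n"
    unfolding r_eq by (simp add: A_def algebra_simps power2_eq_square)
  finally show ?thesis .
qed

text \<open>The recurrence trades P_(n-1) for P_(n+1), and \<open>r_add\<close> simplifies the
  constant term. With \<open>structure_relation\<close> at \<open>Suc n\<close> this closes the
  system for P_(n+1) and P_n.\<close>

lemma structure_relation':
  "[:0, 0, 1:] * pderiv (P n)
     = [:r (Suc n) - t, - (real n + 1 + \<alpha>), 1:] * P n - [:A n, 1:] * P (Suc n)"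
proof -
  have *: "smult (b n) (P (n - 1)) = [:- a n, 1:] * P n - P (Suc n)"
  proof -
    have "smult (b n) (P (n - 1)) = [:0, 1:] * P n - smult (a n) (P n) - P (Suc n)"
      unfolding rec by simp
    also have "\<dots> = [:- a n, 1:] * P n - P (Suc n)"
      by (rule poly_ext) (simp add: algebra_simps)
    finally show ?thesis .
  qed
  have "[:0, 0, 1:] * pderiv (P n)
     = [:- r n, real n:] * P n + [:A n, 1:] * smult (b n) (P (n - 1))"
    unfolding structure_relation by (simp only: mult_smult_right)
  also have "\<dots> = ([:- r n, real n:] + [:A n, 1:] * [:- a n, 1:]) * P n - [:A n, 1:] * P (Suc n)"
    unfolding * by (simp only: ring_distribs mult.assoc)
  also have "[:- r n, real n:] + [:A n, 1:] * [:- a n, 1:]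
      = [:r (Suc n) - t, - (real n + 1 + \<alpha>), 1:]"
  proof -
    have "r (Suc n) = t - a n * A n - r n" using r_add[of n] by linarith
    then show ?thesis by (simp only:) (simp add: A_def)
  qed
  finally show ?thesis .
qed

section \<open>The determinant at the origin\<close>

text \<open>As the \<open>b\<close> are nonzero, the recurrence at x = 0 would carry a common zero
  down to \<open>P 0 = 1\<close>.\<close>

lemma consecutive_nz_at_0: "poly (P (Suc n)) 0 \<noteq> 0 \<or> poly (P n) 0 \<noteq> 0"
proof (induction n)
  case 0
  show ?case by (simp add: P_0)
next
  case (Suc n)
  have "poly (P (Suc (Suc n))) 0 + a (Suc n) * poly (P (Suc n)) 0 + b (Suc n) * poly (P n) 0 = 0"
  proof -
    have "poly ([:0, 1:] * P (Suc n)) 0 = 0" by simp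
    then show ?thesis unfolding rec by simp
  qed
  then show ?case using Suc b_nz[of n] by fastforce
qed

text \<open>The structure relations for \<open>P (n + 1)\<close> and \<open>P n\<close> say that a polynomial matrix maps the
  vector \<open>(P (n + 1), P n)\<close> to \<open>x\<^sup>2\<close> times its derivative. Multiplying by the adjugate
  shows that \<open>x\<^sup>2\<close> divides the determinant, since \<open>0\<close> is not a zero of both polynomials.\<close>
lemma determinant_coeffs:
  fixes n :: nat
  defines "s \<equiv> r (Suc n)"
  shows "s * (s - t) = b (Suc n) * A (Suc n) * A n"
    and "(2 * real (Suc n) + \<alpha>) * s = real (Suc n) * t - b (Suc n) * (A (Suc n) + A n)"
proof -
  define M11 where "M11 = [:- s, real (Suc n):]"
  define M12 where "M12 = smult (b (Suc n)) [:A (Suc n), 1:]"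
  define M21 where "M21 = - [:A n, 1:]"
  define M22 where "M22 = [:s - t, - (real n + 1 + \<alpha>), 1:]"
  define D where "D = M11 * M22 - M12 * M21"
  define d where "d k = [:0, 0, 1:] * pderiv (P k)" for k
  have d1: "d (Suc n) = M11 * P (Suc n) + M12 * P n"
    unfolding d_def structure_relation[of "Suc n"]
    by (rule poly_ext) (simp add: algebra_simps M11_def M12_def s_def)
  have d0: "d n = M21 * P (Suc n) + M22 * P n"
    unfolding d_def structure_relation'[of n] by (simp add: M21_def M22_def s_def)
  have D1: "D * P (Suc n) = M22 * d (Suc n) - M12 * d n"
    unfolding d1 d0 D_def by (simp add: algebra_simps)
  have D0: "D * P n = M11 * d n - M21 * d (Suc n)"
    unfolding d1 d0 D_def by (simp add: algebra_simps)
  have key: "coeff D 0 = 0 \<and> coeff D 1 = 0"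
    if "D * p = [:0, 0, 1:] * q" "poly p 0 \<noteq> 0" for p q
  proof -
    have "coeff (D * p) 0 = 0" "coeff (D * p) 1 = 0"
      unfolding that(1) by simp_all
    then show ?thesis
      using that(2) by (simp add: coeff_mult poly_0_coeff_0)
  qed
  have "D * P (Suc n) = [:0, 0, 1:] * (M22 * pderiv (P (Suc n)) - M12 * pderiv (P n))"
    unfolding D1 d_def by (simp only: right_diff_distrib mult.left_commute)
  moreover have "D * P n = [:0, 0, 1:] * (M11 * pderiv (P n) - M21 * pderiv (P (Suc n)))"
    unfolding D0 d_def by (simp only: right_diff_distrib mult.left_commute)
  ultimately have "coeff D 0 = 0 \<and> coeff D 1 = 0"
    using consecutive_nz_at_0[of n] key by blast
  \<comment> \<open>The constant coefficient of \<open>D\<close> gives the first identity, the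
    linear one the second.\<close>
  then show "s * (s - t) = b (Suc n) * A (Suc n) * A n"
    and "(2 * real (Suc n) + \<alpha>) * s = real (Suc n) * t - b (Suc n) * (A (Suc n) + A n)"
    by (simp_all add: D_def M11_def M12_def M21_def M22_def algebra_simps)
qed

text \<open>The first equation is the linear determinant relation with \<open>r n\<close> replaced
  through \<open>r_eq\<close>; the second is the quadratic one multiplied by
  \<open>k\<^sup>2\<close>.\<close>

lemma difference_system:
  assumes "n \<ge> 1"
  shows "\<alpha> * t + 2 * b n * (a n + a (n - 1))
           + (2 * real n + \<alpha>) * (a n * (2 * real n + 2 + \<alpha> - a n) - 3 * b n - b (n + 1)) = 0"
    and "(real n * t - b n * (a n + a (n - 1) - 4 * real n - 2 * \<alpha>))
           * ((real n + \<alpha>) * t + b n * (a n + a (n - 1) - 4 * real n - 2 * \<alpha>))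
         + (2 * real n + \<alpha>)^2 * b n * (a n - 2 * real n - 1 - \<alpha>)
           * (a (n - 1) - 2 * real n + 1 - \<alpha>) = 0"
proof -
  obtain m where n: "n = Suc m" using assms by (cases n) auto
  define k where "k = 2 * real n + \<alpha>"
  define B where "B = b n * (a n + a (n - 1) - 4 * real n - 2 * \<alpha>)"
  have A: "A n = a n - 2 * real n - 1 - \<alpha>" "A m = a (n - 1) - 2 * real n + 1 - \<alpha>"
    by (simp_all add: A_def n)
  have sq: "r n * (r n - t) = b n * A n * A m"
    using determinant_coeffs(1)[of m] by (simp add: n)
  have "k * r n = real n * t - b n * (A n + A m)"
    using determinant_coeffs(2)[of m] by (simp add: n k_def)
  also have "b n * (A n + A m) = B" by (simp add: A B_def algebra_simps)
  finally have lin: "k * r n = real n * t - B" .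
  have "\<alpha> * t + 2 * b n * (a n + a (n - 1))
      + k * (a n * (2 * real n + 2 + \<alpha> - a n) - 3 * b n - b (n + 1))
    = k * (2 * r n) - 2 * (real n * t - B)"
    unfolding r_eq by (simp add: k_def B_def algebra_simps power2_eq_square)
  then show "\<alpha> * t + 2 * b n * (a n + a (n - 1))
           + (2 * real n + \<alpha>) * (a n * (2 * real n + 2 + \<alpha> - a n) - 3 * b n - b (n + 1)) = 0"
    using lin by (simp add: k_def)
  \<comment> \<open>The left side is \<open>k * t\<close> minus the right side of
    \<open>lin\<close>, because \<open>k\<close> is the sum of \<open>n\<close> and
    \<open>n + \<alpha>\<close>.\<close>
  have lin': "(real n + \<alpha>) * t + B = k * (t - r n)"
    using lin by (simp add: k_def algebra_simps)
  have "(real n * t - B) * ((real n + \<alpha>) * t + B) + k\<^sup>2 * b n * A n * A m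
      = k\<^sup>2 * (b n * A n * A m - r n * (r n - t))"
    unfolding lin[symmetric] lin' by (simp add: algebra_simps power2_eq_square)
  then show "(real n * t - b n * (a n + a (n - 1) - 4 * real n - 2 * \<alpha>))
           * ((real n + \<alpha>) * t + b n * (a n + a (n - 1) - 4 * real n - 2 * \<alpha>))
         + (2 * real n + \<alpha>)^2 * b n * (a n - 2 * real n - 1 - \<alpha>)
           * (a (n - 1) - 2 * real n + 1 - \<alpha>) = 0"
    unfolding sq A B_def k_def by simp
qed

end

section \<open>Analysis of the weight: integrability, boundary limits, Pearson equation\<close>

lemma weight_nonneg: "0 \<le> weight t \<alpha> x"
  by (simp add: weight_def)

text \<open>Domination by the Laguerre weight reduces integrability and limits to the case
  \<open>t = 0\<close>.\<close>

lemma weight_le: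
  assumes "t \<ge> 0" "x > 0"
  shows "weight t \<alpha> x \<le> x powr \<alpha> * exp (- x)"
  using assms by (auto simp: weight_def intro!: mult_left_mono)

text \<open>Since w'/w = \<alpha>/x - 1 + t/x^2, the factor x^2 clears all denominators.\<close>

lemma has_derivative_weight:
  assumes "x > 0"
  shows "((\<lambda>x. x\<^sup>2 * poly p x * weight t \<alpha> x) has_real_derivative
     poly ([:0, 0, 1:] * pderiv p + [:t, 2 + \<alpha>, -1:] * p) x * weight t \<alpha> x) (at x)"
proof -
  have "x powr (\<alpha> - 1) = x powr \<alpha> / x"
    using assms by (simp add: powr_diff)
  then show ?thesis
    unfolding weight_def using assms
    by (auto intro!: derivative_eq_intros simp: field_simps power2_eq_square)
qed

lemma set_integrable_monomial_weight:
  assumes "\<alpha> > -1" "t \<ge> 0"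
  shows "set_integrable lborel {0<..} (\<lambda>x. x ^ k * weight t \<alpha> x)"
proof (rule set_integrable_bound)
  \<comment> \<open>The integrand of Gamma at \<open>\<alpha> + 1 + k\<close>, which is positive
    because \<open>\<alpha> > -1\<close>.\<close>
  let ?g = "\<lambda>x. x powr (\<alpha> + 1 + real k - 1) / exp x"
  have "?g integrable_on {0..}"
    using Gamma_integral_real[of "\<alpha> + 1 + real k"] assms by (auto simp: integrable_on_def)
  then have "?g absolutely_integrable_on {0..}"
    by (rule nonnegative_absolutely_integrable_1) auto
  then have "set_integrable lebesgue {0<..} ?g"
    by (rule set_integrable_subset) auto
  then show "set_integrable lborel {0<..} ?g"
    unfolding set_integrable_def by (subst (asm) integrable_completion) auto
  show "set_borel_measurable lborel {0<..} (\<lambda>x. x ^ k * weight t \<alpha> x)"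
    unfolding set_borel_measurable_def weight_def by measurable
  have "norm (x ^ k * weight t \<alpha> x) \<le> norm (?g x)" if "x > 0" for x
  proof -
    have "x ^ k * weight t \<alpha> x \<le> x ^ k * (x powr \<alpha> * exp (- x))"
      using that assms by (intro mult_left_mono weight_le) auto
    also have "\<dots> = ?g x"
      using that by (simp add: powr_add powr_realpow exp_minus field_simps)
    finally show ?thesis
      using that weight_nonneg[of t \<alpha> x] by (simp add: abs_mult)
  qed
  then show "AE x in lborel. x \<in> {0<..} \<longrightarrow> norm (x ^ k * weight t \<alpha> x) \<le> norm (?g x)"
    by auto
qed

lemma set_integrable_poly_weight:
  assumes "\<alpha> > -1" "t \<ge> 0"
  shows "set_integrable lborel {0<..} (\<lambda>x. poly p x * weight t \<alpha> x)"
proof -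
  have "set_integrable lborel {0<..} (\<lambda>x. coeff p i * (x ^ i * weight t \<alpha> x))" for i
    using set_integrable_monomial_weight[OF assms] by simp
  then have "set_integrable lborel {0<..}
      (\<lambda>x. \<Sum>i\<le>degree p. coeff p i * (x ^ i * weight t \<alpha> x))"
    unfolding set_integrable_def scaleR_sum_right by (intro Bochner_Integration.integrable_sum)
  then show ?thesis
    by (simp add: poly_altdef sum_distrib_right mult.assoc)
qed

lemma tendsto_poly_weight_0:
  assumes "\<alpha> > -1" "t \<ge> 0"
  shows "((\<lambda>x. x\<^sup>2 * poly p x * weight t \<alpha> x) \<longlongrightarrow> 0) (at_right 0)"
proof -
  have "((\<lambda>x. x\<^sup>2 * weight t \<alpha> x) \<longlongrightarrow> 0) (at_right 0)"
  proof (rule tendsto_sandwich[where f = "\<lambda>_. 0"])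
    show "((\<lambda>x. x\<^sup>2 * (x powr \<alpha> * exp (- x))) \<longlongrightarrow> 0) (at_right 0)"
      using assms by real_asymp
    show "\<forall>\<^sub>F x in at_right 0. x\<^sup>2 * weight t \<alpha> x \<le> x\<^sup>2 * (x powr \<alpha> * exp (- x))"
      using eventually_at_right_less[of "0::real"]
      by eventually_elim (intro mult_left_mono weight_le assms, auto)
  qed (auto simp: weight_nonneg)
  then have "((\<lambda>x. poly p x * (x\<^sup>2 * weight t \<alpha> x)) \<longlongrightarrow> poly p 0 * 0) (at_right 0)"
    by (intro tendsto_mult tendsto_poly tendsto_ident_at)
  then show ?thesis by (simp add: mult_ac)
qed

lemma tendsto_poly_weight_at_top:
  assumes "t \<ge> 0"
  shows "((\<lambda>x. x\<^sup>2 * poly p x * weight t \<alpha> x) \<longlongrightarrow> 0) at_top"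
proof -
  have "((\<lambda>x. x ^ k * weight t \<alpha> x) \<longlongrightarrow> 0) at_top" for k
  proof (rule tendsto_sandwich[where f = "\<lambda>_. 0"])
    show "((\<lambda>x. x ^ k * (x powr \<alpha> * exp (- x))) \<longlongrightarrow> 0) at_top"
      by real_asymp
    show "\<forall>\<^sub>F x in at_top. x ^ k * weight t \<alpha> x \<le> x ^ k * (x powr \<alpha> * exp (- x))"
      using eventually_gt_at_top[of "0::real"]
      by eventually_elim (intro mult_left_mono weight_le assms, auto)
    show "\<forall>\<^sub>F x in at_top. 0 \<le> x ^ k * weight t \<alpha> x"
      using eventually_gt_at_top[of "0::real"]
      by eventually_elim (auto simp: weight_nonneg)
  qed auto
  then have "((\<lambda>x. \<Sum>i\<le>degree p. coeff p i * (x ^ (2 + i) * weight t \<alpha> x)) \<longlongrightarrow> 0) at_top"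
    by (intro tendsto_null_sum tendsto_mult_right_zero)
  moreover have "(\<Sum>i\<le>degree p. coeff p i * (x ^ (2 + i) * weight t \<alpha> x))
      = x\<^sup>2 * poly p x * weight t \<alpha> x" for x
    by (simp only: poly_altdef sum_distrib_left sum_distrib_right power_add mult_ac)
  ultimately show ?thesis by simp
qed

text \<open>The integrand has antiderivative x^2 p w, which tends to 0 at both ends of the
  half-line.\<close>

lemma pearson_weight:
  assumes "\<alpha> > -1" "t \<ge> 0"
  shows "(LINT x:{0<..}|lborel.
      poly ([:0, 0, 1:] * pderiv p + [:t, 2 + \<alpha>, -1:] * p) x * weight t \<alpha> x) = 0"
proof -
  let ?q = "[:0, 0, 1:] * pderiv p + [:t, 2 + \<alpha>, -1:] * p"
  have "(LBINT x=ereal 0..\<infinity>. poly ?q x * weight t \<alpha> x) = 0 - 0"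
  proof (rule interval_integral_FTC_integrable)
    fix x assume "ereal 0 < ereal x"
    then have "x > 0" by simp
    then show "((\<lambda>x. x\<^sup>2 * poly p x * weight t \<alpha> x) has_vector_derivative
        poly ?q x * weight t \<alpha> x) (at x)"
      using has_derivative_weight
      by (simp only: has_real_derivative_iff_has_vector_derivative[symmetric])
    show "isCont (\<lambda>x. poly ?q x * weight t \<alpha> x) x"
      unfolding weight_def using \<open>x > 0\<close> by (intro continuous_intros) auto
  next
    show "set_integrable lborel (einterval (ereal 0) \<infinity>) (\<lambda>x. poly ?q x * weight t \<alpha> x)"
      using set_integrable_poly_weight[OF assms, of ?q] by simp
  qed (simp_all only: ereal_tendsto_simps tendsto_poly_weight_0[OF assms]
       tendsto_poly_weight_at_top[OF assms(2)], simp)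
  then show ?thesis
    by (simp add: interval_integral_to_infinity_eq del: poly_add poly_mult poly_pCons)
qed

section \<open>Specialization to the integral against the weight\<close>

theorem theorem2p4:
  fixes t \<alpha> :: real and P :: "nat \<Rightarrow> real poly" and a b :: "nat \<Rightarrow> real" and n :: nat
  assumes "\<alpha> > -1" and "t \<ge> 0"
    and "monic_orthogonal_polynomials (weight t \<alpha>) P"
    and "recurrence_coefficients P a b"
    and "n \<ge> 1"
  shows "\<alpha> * t + 2 * b n * (a n + a (n - 1))
           + (2 * real n + \<alpha>) * (a n * (2 * real n + 2 + \<alpha> - a n) - 3 * b n - b (n + 1)) = 0
       \<and> (real n * t - b n * (a n + a (n - 1) - 4 * real n - 2 * \<alpha>))
           * ((real n + \<alpha>) * t + b n * (a n + a (n - 1) - 4 * real n - 2 * \<alpha>))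
         + (2 * real n + \<alpha>)^2 * b n * (a n - 2 * real n - 1 - \<alpha>)
           * (a (n - 1) - 2 * real n + 1 - \<alpha>) = 0"
proof -
  obtain h where h: "\<And>j. h j > 0"
    "\<And>j k. (LINT x:{0<..}|lborel. poly (P j) x * poly (P k) x * weight t \<alpha> x)
       = (if j = k then h j else 0)"
    using assms(3) unfolding monic_orthogonal_polynomials_def by blast
  have P: "degree (P k) = k" "coeff (P k) k = 1" for k
    using assms(3) unfolding monic_orthogonal_polynomials_def by metis+
  define L where "L p = (LINT x:{0<..}|lborel. poly p x * weight t \<alpha> x)" for p
  note int = set_integrable_poly_weight[OF assms(1,2)]
  \<comment> \<open>\<open>b 0\<close> is unconstrained, so it is reset to 0; for
    \<open>n \<ge> 1\<close> the claim involves only \<open>b n\<close> and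
    \<open>b (n + 1)\<close>, which are unchanged.\<close>
  interpret semiclassical_functional L P a "b(0 := 0)" h t \<alpha>
  proof
    show "L (p + q) = L p + L q" for p q
      unfolding L_def using int by (simp add: distrib_right set_integral_add)
    show "L (smult c p) = c * L p" for c p
      unfolding L_def by (simp add: mult.assoc)
    show "L ([:0, 0, 1:] * pderiv p + [:t, 2 + \<alpha>, -1:] * p) = 0" for p
      unfolding L_def by (rule pearson_weight[OF assms(1,2)])
    show "L (P j * P k) = (if j = k then h j else 0)" for j k
      unfolding L_def using h(2)[of j k] by simp
    show "h k \<noteq> 0" for k using h(1)[of k] by simp
    show "[:0, 1:] * P k = P (Suc k) + smult (a k) (P k) + smult ((b(0 := 0)) k) (P (k - 1))" for k
      using assms(4) unfolding recurrence_coefficients_def by auto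
  qed (simp_all add: P)
  show ?thesis
    using difference_system[OF assms(5)] assms(5) by simp
qed

end
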